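(* The combing path system induced by a quasi-consistent, bounded, quasi-geodesic bicombing on a geodesic metric space $X$ is navigable.
   Context: A $(\lambda,\kappa)$-quasi-geodesic ($\lambda\ge1,\kappa\ge0$) is a map $\gamma:I\to X$, $I\subseteq\mathbb R$ an interval, with $\frac1\lambda|t_1-t_2|-\kappa\le d(\gamma(t_1),\gamma(t_2))\le\lambda|t_1-t_2|+\kappa$. Convention: all quasi-geodesics are improved, i.e. continuous and such that the length of $\gamma|_{[t,t']}$ is at most $k_1d(\gamma(t),\gamma(t'))+k_2$, where $\kappa'=2(\lambda+\kappa)$, $k_1=\lambda(\lambda+\kappa)$, $k_2=(\lambda\kappa'+3)(\lambda+\kappa)$. A $(\lambda_0,\kappa_0)$-quasi-geodesic bicombing assigns to every ordered pair $(x,y)\in X\times X$ a $(\lambda_0,\kappa_0)$-quasi-geodesic $q_{xy}$ (combing line) from $x$ to $y$, with domain starting at $0$ and extended to $\mathbb R$ by constant maps. It is ($\kappa_0$-)bounded if $d(q_{x_1y_1}(t),q_{x_2y_2}(t))\le\kappa_0[d(x_1,x_2)+d(y_1,y_2)]+\kappa_0$ for all $t\in\mathbb R$, $x_i,y_i\in X$. It is ($\kappa_0$-)quasi-consistent if for every combing line $q_{xy}$ and points $z_1,z_2$ on it, the Hausdorff distance between the (maximal) subpath of $q_{xy}$ between $z_1$ and $z_2$ and $q_{z_1z_2}$ is at most $\kappa_0$. The induced combing path system $\mathcal P$ consists of all combing lines, their reverses, the trivial paths at all points, and all subsegments of these. An $(n,\mathcal P)$-polygonal line is a concatenation of at most $n$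 paths of $\mathcal P$; $\alpha^\pm$ denote endpoints and $\|p\|$ length. $\mathcal P$ is navigable if there are $C\ge1$ and an integer $k\ge1$ such that for every $R\ge C$, $m\in X$, $n$, and $(n,\mathcal P)$-polygonal line $\alpha$ with $d(\alpha,m)\ge R$ and $d(\alpha^\pm,m)\le2R$, there is a $(kn,\mathcal P)$-polygonal line $p$ with the same endpoints as $\alpha$, $\|p\|\le CnR$, avoiding the closed ball $B(m,R/C)$. *)

theory Defs
  imports "HOL-Analysis.Analysis"
begin

definition geodesic_space :: "'a::metric_space itself \<Rightarrow> bool" where
  "geodesic_space _ \<longleftrightarrow>
    (\<forall>x y::'a. \<exists>g::real \<Rightarrow> 'a. g 0 = x \<and> g (dist x y) = y \<and>
      (\<forall>s\<in>{0..dist x y}. \<forall>t\<in>{0..dist x y}. dist (g s) (g t) = \<bar>s - t\<bar>))"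

text \<open>The length is the supremum over all subdivisions of \<open>[a, b]\<close>; it may be infinite.\<close>

definition curve_length :: "real \<Rightarrow> real \<Rightarrow> (real \<Rightarrow> 'a::metric_space) \<Rightarrow> ereal" where
  "curve_length a b \<gamma> =
    Sup {ereal (\<Sum>i<n. dist (\<gamma> (t i)) (\<gamma> (t (Suc i)))) | (n::nat) (t::nat \<Rightarrow> real).
           (\<forall>i\<le>n. a \<le> t i \<and> t i \<le> b) \<and> (\<forall>i<n. t i \<le> t (Suc i))}"

definition hausdorff_distance :: "'a::metric_space set \<Rightarrow> 'a set \<Rightarrow> ereal" where
  "hausdorff_distance A B =
    max (SUP a\<in>A. ereal (infdist a B)) (SUP b\<in>B. ereal (infdist b A))"


definition quasi_geodesic :: "real \<Rightarrow> real \<Rightarrow> real set \<Rightarrow> (real \<Rightarrow> 'a::metric_space) \<Rightarrow> bool" where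
  "quasi_geodesic l k I \<gamma> \<longleftrightarrow> l \<ge> 1 \<and> k \<ge> 0 \<and> is_interval I \<and>
    (\<forall>s\<in>I. \<forall>t\<in>I. \<bar>s - t\<bar> / l - k \<le> dist (\<gamma> s) (\<gamma> t) \<and> dist (\<gamma> s) (\<gamma> t) \<le> l * \<bar>s - t\<bar> + k)"

definition improved_quasi_geodesic ::
  "real \<Rightarrow> real \<Rightarrow> real set \<Rightarrow> (real \<Rightarrow> 'a::metric_space) \<Rightarrow> bool" where
  "improved_quasi_geodesic l k I \<gamma> \<longleftrightarrow> quasi_geodesic l k I \<gamma> \<and> continuous_on I \<gamma> \<and>
    (let k' = 2 * (l + k); k1 = l * (l + k); k2 = (l * k' + 3) * (l + k) in
      \<forall>s\<in>I. \<forall>t\<in>I. s \<le> t \<longrightarrow> curve_length s t \<gamma> \<le> ereal (k1 * dist (\<gamma> s) (\<gamma> t) + k2))"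

text \<open>
  A bicombing is given by its combing lines \<open>q x y\<close>, already extended to all of \<open>\<real>\<close>, together
  with the right end points \<open>T x y\<close> of their domains \<open>[0, T x y]\<close>.
\<close>

definition quasi_geodesic_bicombing ::
  "real \<Rightarrow> real \<Rightarrow> ('a \<Rightarrow> 'a \<Rightarrow> real \<Rightarrow> 'a::metric_space) \<Rightarrow> ('a \<Rightarrow> 'a \<Rightarrow> real) \<Rightarrow> bool" where
  "quasi_geodesic_bicombing l k q T \<longleftrightarrow>
    (\<forall>x y. 0 \<le> T x y \<and> q x y 0 = x \<and> q x y (T x y) = y \<and>
       improved_quasi_geodesic l k {0..T x y} (q x y) \<and>
       (\<forall>t\<le>0. q x y t = x) \<and> (\<forall>t\<ge>T x y. q x y t = y))"

definition bounded_bicombing :: "real \<Rightarrow> ('a \<Rightarrow> 'a \<Rightarrow> real \<Rightarrow> 'a::metric_space) \<Rightarrow> bool" where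
  "bounded_bicombing k q \<longleftrightarrow>
    (\<forall>x1 y1 x2 y2 t. dist (q x1 y1 t) (q x2 y2 t) \<le> k * (dist x1 x2 + dist y1 y2) + k)"

text \<open>
  A combing line may visit a point several times (within a bounded time interval), so a subpath
  between two points need not be unique; the maximal ones are those whose parameter interval is
  maximal with respect to inclusion.  The two points may be visited in either order.
\<close>

definition subpath_between ::
  "(real \<Rightarrow> 'a) \<Rightarrow> real \<Rightarrow> 'a \<Rightarrow> 'a \<Rightarrow> real \<Rightarrow> real \<Rightarrow> bool" where
  "subpath_between \<gamma> L z1 z2 s t \<longleftrightarrow> 0 \<le> s \<and> s \<le> t \<and> t \<le> L \<and>
    (\<gamma> s = z1 \<and> \<gamma> t = z2 \<or> \<gamma> s = z2 \<and> \<gamma> t = z1)"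

definition maximal_subpath_between ::
  "(real \<Rightarrow> 'a) \<Rightarrow> real \<Rightarrow> 'a \<Rightarrow> 'a \<Rightarrow> real \<Rightarrow> real \<Rightarrow> bool" where
  "maximal_subpath_between \<gamma> L z1 z2 s t \<longleftrightarrow> subpath_between \<gamma> L z1 z2 s t \<and>
    (\<forall>s' t'. subpath_between \<gamma> L z1 z2 s' t' \<and> {s..t} \<subseteq> {s'..t'} \<longrightarrow> s' = s \<and> t' = t)"

definition quasi_consistent ::
  "real \<Rightarrow> ('a \<Rightarrow> 'a \<Rightarrow> real \<Rightarrow> 'a::metric_space) \<Rightarrow> ('a \<Rightarrow> 'a \<Rightarrow> real) \<Rightarrow> bool" where
  "quasi_consistent k q T \<longleftrightarrow>
    (\<forall>x y. \<forall>z1 \<in> q x y ` {0..T x y}. \<forall>z2 \<in> q x y ` {0..T x y}. \<forall>s t.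
       maximal_subpath_between (q x y) (T x y) z1 z2 s t \<longrightarrow>
       hausdorff_distance (q x y ` {s..t}) (q z1 z2 ` {0..T z1 z2}) \<le> ereal k)"

text \<open>
  Members of path systems and polygonal lines are parametrized (affinely) over \<open>[0, 1]\<close>, as usual
  in the library; images, end points and lengths do not depend on this choice.  The library's
  \<open>subpath\<close> does the same as \<open>subsegment\<close>, but only in normed vector spaces.
\<close>

definition subsegment :: "real \<Rightarrow> real \<Rightarrow> (real \<Rightarrow> 'a) \<Rightarrow> real \<Rightarrow> 'a" where
  "subsegment s t \<gamma> = (\<lambda>u. \<gamma> ((t - s) * u + s))"

definition combing_lines ::
  "('a \<Rightarrow> 'a \<Rightarrow> real \<Rightarrow> 'a) \<Rightarrow> ('a \<Rightarrow> 'a \<Rightarrow> real) \<Rightarrow> (real \<Rightarrow> 'a) set" where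
  "combing_lines q T = {subsegment 0 (T x y) (q x y) | x y. True}"

definition combing_path_system ::
  "('a \<Rightarrow> 'a \<Rightarrow> real \<Rightarrow> 'a::metric_space) \<Rightarrow> ('a \<Rightarrow> 'a \<Rightarrow> real) \<Rightarrow> (real \<Rightarrow> 'a) set" where
  "combing_path_system q T =
    {subsegment s t \<gamma> | s t \<gamma>. 0 \<le> s \<and> s \<le> t \<and> t \<le> 1 \<and>
       \<gamma> \<in> combing_lines q T \<union> reversepath ` combing_lines q T \<union> range (\<lambda>x _. x)}"

text \<open>The full paths are included in the above set, as subsegments over \<open>[0, 1]\<close>:\<close>

lemma subsegment_0_1 [simp]: "subsegment 0 1 \<gamma> = \<gamma>"
  by (simp add: subsegment_def)

fun join_path_list :: "(real \<Rightarrow> 'a::topological_space) list \<Rightarrow> real \<Rightarrow> 'a" where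
  "join_path_list [] = undefined"
| "join_path_list [p] = p"
| "join_path_list (p # p' # ps) = p +++ join_path_list (p' # ps)"

definition polygonal_line ::
  "nat \<Rightarrow> (real \<Rightarrow> 'a::topological_space) set \<Rightarrow> (real \<Rightarrow> 'a) \<Rightarrow> bool" where
  "polygonal_line n P \<alpha> \<longleftrightarrow>
    (\<exists>ps. ps \<noteq> [] \<and> length ps \<le> n \<and> set ps \<subseteq> P \<and>
       successively (\<lambda>p p'. pathfinish p = pathstart p') ps \<and> \<alpha> = join_path_list ps)"

definition navigable :: "(real \<Rightarrow> 'a::metric_space) set \<Rightarrow> bool" where
  "navigable P \<longleftrightarrow>
    (\<exists>(C::real) (k::nat). C \<ge> 1 \<and> k \<ge> 1 \<and>
      (\<forall>(R::real) (m::'a) (n::nat) \<alpha>.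
         R \<ge> C \<and> polygonal_line n P \<alpha> \<and> infdist m (path_image \<alpha>) \<ge> R \<and>
         dist (pathstart \<alpha>) m \<le> 2 * R \<and> dist (pathfinish \<alpha>) m \<le> 2 * R \<longrightarrow>
         (\<exists>p. polygonal_line (k * n) P p \<and>
              pathstart p = pathstart \<alpha> \<and> pathfinish p = pathfinish \<alpha> \<and>
              curve_length 0 1 p \<le> ereal (C * real n * R) \<and>
              path_image p \<inter> cball m (R / C) = {})))"

end

theory Submission
  imports Defs
begin

text \<open>
  Fix a large multiple \<open>\<tau>\<close> of \<open>R\<close> and project each vertex \<open>x\<close> of the polygonal line to the point
  \<open>\<pi> x = q m x (min \<tau> (T m x))\<close> at time \<open>\<tau>\<close> on the ray from \<open>m\<close> to \<open>x\<close>.  The projections of the two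
  end points \<open>a\<close>, \<open>b\<close> of a piece can be joined by six paths at scale \<open>R\<close>, however long the piece
  is: slide \<open>w\<close> from \<open>b\<close> along the ray towards \<open>m\<close> until the combing line from \<open>a\<close> to \<open>w\<close> first
  passes near \<open>m\<close>, at a point \<open>u\<close> say.  By boundedness this line is still far enough from \<open>m\<close>.
  As \<open>u\<close> is near \<open>m\<close>, boundedness and quasi-consistency show that at time \<open>\<tau>\<close> its two halves,
  from \<open>u\<close> to \<open>a\<close> and from \<open>u\<close> to \<open>w\<close>, are so close to the rays from \<open>m\<close> to \<open>a\<close> and to \<open>w\<close> that
  short combing lines between them miss the ball around \<open>m\<close>.
\<close>

section \<open>Length under reparametrization, splitting and concatenation\<close>

lemma curve_length_leI:
  assumes "\<And>n t. \<lbrakk>\<And>i. i \<le> n \<Longrightarrow> a \<le> t i \<and> t i \<le> b; \<And>i. i < n \<Longrightarrow> t i \<le> t (Suc i)\<rbrakk>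
      \<Longrightarrow> ereal (\<Sum>i<n. dist (\<gamma> (t i)) (\<gamma> (t (Suc i)))) \<le> B"
  shows "curve_length a b \<gamma> \<le> B"
  unfolding curve_length_def by (rule Sup_least) (use assms in blast)

lemma curve_length_ge:
  assumes "\<And>i. i \<le> n \<Longrightarrow> a \<le> t i \<and> t i \<le> b" and "\<And>i. i < n \<Longrightarrow> t i \<le> t (Suc i)"
  shows "ereal (\<Sum>i<n. dist (\<gamma> (t i)) (\<gamma> (t (Suc i)))) \<le> curve_length a b \<gamma>"
  unfolding curve_length_def by (rule Sup_upper) (use assms in blast)

lemma curve_length_reparam_mono:
  assumes "\<And>u v. a \<le> u \<Longrightarrow> u \<le> v \<Longrightarrow> v \<le> b \<Longrightarrow> \<phi> u \<le> \<phi> v"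
    and "\<And>u. a \<le> u \<Longrightarrow> u \<le> b \<Longrightarrow> c \<le> \<phi> u \<and> \<phi> u \<le> d \<and> p u = \<gamma> (\<phi> u)"
  shows "curve_length a b p \<le> curve_length c d \<gamma>"
proof (rule curve_length_leI)
  fix n t
  assume t: "\<And>i. i \<le> n \<Longrightarrow> a \<le> t i \<and> t i \<le> b" "\<And>i. i < n \<Longrightarrow> t i \<le> t (Suc i)"
  have "(\<Sum>i<n. dist (p (t i)) (p (t (Suc i)))) = (\<Sum>i<n. dist (\<gamma> (\<phi> (t i))) (\<gamma> (\<phi> (t (Suc i)))))"
    by (intro sum.cong refl) (simp add: assms(2) t)
  also have "ereal \<dots> \<le> curve_length c d \<gamma>"
    by (rule curve_length_ge) (use assms t in auto)
  finally show "ereal (\<Sum>i<n. dist (p (t i)) (p (t (Suc i)))) \<le> curve_length c d \<gamma>" .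
qed

lemma curve_length_reparam_antimono:
  assumes "\<And>u v. a \<le> u \<Longrightarrow> u \<le> v \<Longrightarrow> v \<le> b \<Longrightarrow> \<phi> v \<le> \<phi> u"
    and "\<And>u. a \<le> u \<Longrightarrow> u \<le> b \<Longrightarrow> c \<le> \<phi> u \<and> \<phi> u \<le> d \<and> p u = \<gamma> (\<phi> u)"
  shows "curve_length a b p \<le> curve_length c d \<gamma>"
proof (rule curve_length_leI)
  fix n t
  assume t: "\<And>i. i \<le> n \<Longrightarrow> a \<le> t i \<and> t i \<le> b" "\<And>i. i < n \<Longrightarrow> t i \<le> t (Suc i)"
  \<comment> \<open>The subdivision is read backwards, because \<phi> reverses the order.\<close>
  define t' where "t' i = \<phi> (t (n - i))" for i
  have "(\<Sum>i<n. dist (p (t i)) (p (t (Suc i)))) =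
      (\<Sum>i<n. dist (p (t (n - Suc i))) (p (t (Suc (n - Suc i)))))"
    by (rule sum.nat_diff_reindex[symmetric])
  also have "\<dots> = (\<Sum>i<n. dist (\<gamma> (t' i)) (\<gamma> (t' (Suc i))))"
    by (intro sum.cong refl) (simp add: assms(2) t t'_def dist_commute Suc_diff_Suc)
  also have "ereal \<dots> \<le> curve_length c d \<gamma>"
  proof (rule curve_length_ge)
    fix i assume "i < n"
    then have "t (n - Suc i) \<le> t (n - i)"
      using t(2)[of "n - Suc i"] by (simp add: Suc_diff_Suc)
    then show "t' i \<le> t' (Suc i)"
      by (simp add: t'_def assms(1) t)
  qed (simp add: t'_def assms(2) t)
  finally show "ereal (\<Sum>i<n. dist (p (t i)) (p (t (Suc i)))) \<le> curve_length c d \<gamma>" .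
qed

lemma curve_length_split:
  assumes "a \<le> b" "b \<le> c"
  shows "curve_length a c \<gamma> \<le> curve_length a b \<gamma> + curve_length b c \<gamma>"
proof (rule curve_length_leI)
  fix n t
  assume t: "\<And>i. i \<le> n \<Longrightarrow> a \<le> t i \<and> t i \<le> c" "\<And>i. i < n \<Longrightarrow> t i \<le> t (Suc i)"
  \<comment> \<open>Truncating at \<open>b\<close> subdivides both halves. Only an interval
    straddling \<open>b\<close> is genuinely cut, and there the triangle inequality through
    \<open>\<gamma> b\<close> applies.\<close>
  define u v where "u i = min (t i) b" and "v i = max (t i) b" for i
  have "dist (\<gamma> (t i)) (\<gamma> (t (Suc i)))
      \<le> dist (\<gamma> (u i)) (\<gamma> (u (Suc i))) + dist (\<gamma> (v i)) (\<gamma> (v (Suc i)))" if "i < n" for i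
    using t(2)[OF that] dist_triangle[of "\<gamma> (t i)" "\<gamma> (t (Suc i))" "\<gamma> b"]
    by (auto simp: u_def v_def min_def max_def)
  then have "(\<Sum>i<n. dist (\<gamma> (t i)) (\<gamma> (t (Suc i)))) \<le>
      (\<Sum>i<n. dist (\<gamma> (u i)) (\<gamma> (u (Suc i)))) + (\<Sum>i<n. dist (\<gamma> (v i)) (\<gamma> (v (Suc i))))"
    by (subst sum.distrib[symmetric]) (rule sum_mono, simp)
  then have "ereal (\<Sum>i<n. dist (\<gamma> (t i)) (\<gamma> (t (Suc i)))) \<le>
      ereal (\<Sum>i<n. dist (\<gamma> (u i)) (\<gamma> (u (Suc i)))) + ereal (\<Sum>i<n. dist (\<gamma> (v i)) (\<gamma> (v (Suc i))))"
    by simp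
  also have "\<dots> \<le> curve_length a b \<gamma> + curve_length b c \<gamma>"
  proof (intro add_mono curve_length_ge)
    fix i
    show "a \<le> u i \<and> u i \<le> b" "b \<le> v i \<and> v i \<le> c" if "i \<le> n"
      using t(1)[OF that] assms by (auto simp: u_def v_def)
    show "u i \<le> u (Suc i)" "v i \<le> v (Suc i)" if "i < n"
      using t(2)[OF that] by (auto simp: u_def v_def)
  qed
  finally show "ereal (\<Sum>i<n. dist (\<gamma> (t i)) (\<gamma> (t (Suc i))))
      \<le> curve_length a b \<gamma> + curve_length b c \<gamma>" .
qed

lemma curve_length_join:
  assumes "pathfinish p = pathstart p'"
  shows "curve_length 0 1 (p +++ p') \<le> curve_length 0 1 p + curve_length 0 1 p'"
proof -
  have "curve_length 0 (1/2) (p +++ p') \<le> curve_length 0 1 p"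
    by (rule curve_length_reparam_mono[where \<phi> = "\<lambda>u. 2 * u"]) (auto simp: joinpaths_def)
  \<comment> \<open>At \<open>1/2\<close> the join still follows \<open>p\<close>, so the matching
    ends are needed there.\<close>
  moreover have "(p +++ p') u = p' (2 * u - 1)" if "1/2 \<le> u" for u
  proof (cases "u = 1/2")
    case True
    with assms show ?thesis
      unfolding True by (simp add: joinpaths_def pathfinish_def pathstart_def)
  qed (use that in \<open>auto simp: joinpaths_def\<close>)
  then have "curve_length (1/2) 1 (p +++ p') \<le> curve_length 0 1 p'"
    by (intro curve_length_reparam_mono[where \<phi> = "\<lambda>u. 2 * u - 1"]) auto
  ultimately have "curve_length 0 (1/2) (p +++ p') + curve_length (1/2) 1 (p +++ p')
      \<le> curve_length 0 1 p + curve_length 0 1 p'"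
    by (rule add_mono)
  then show ?thesis
    using curve_length_split[of 0 "1/2" 1 "p +++ p'"] by simp
qed

lemma curve_length_reversepath: "curve_length 0 1 (reversepath p) \<le> curve_length 0 1 p"
  by (rule curve_length_reparam_antimono[where \<phi> = "\<lambda>u. 1 - u"]) (auto simp: reversepath_def)

section \<open>Concatenations and chains of steps\<close>

lemma path_ends_join_path_list:
  assumes "ps \<noteq> []"
  shows "pathstart (join_path_list ps) = pathstart (hd ps)"
    and "pathfinish (join_path_list ps) = pathfinish (last ps)"
  using assms by (induction ps rule: join_path_list.induct) auto

lemma path_image_join_path_list:
  assumes "ps \<noteq> []" "successively (\<lambda>p p'. pathfinish p = pathstart p') ps"
  shows "path_image (join_path_list ps) = (\<Union>p\<in>set ps. path_image p)"
  using assms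
  by (induction ps rule: join_path_list.induct) (auto simp: path_image_join path_ends_join_path_list)

lemma curve_length_join_path_list:
  assumes "ps \<noteq> []" "successively (\<lambda>p p'. pathfinish p = pathstart p') ps"
    and "\<And>p. p \<in> set ps \<Longrightarrow> curve_length 0 1 p \<le> ereal L"
  shows "curve_length 0 1 (join_path_list ps) \<le> ereal (real (length ps) * L)"
  using assms
proof (induction ps rule: join_path_list.induct)
  case (3 p p' ps)
  have "curve_length 0 1 (p +++ join_path_list (p' # ps))
      \<le> curve_length 0 1 p + curve_length 0 1 (join_path_list (p' # ps))"
    using 3(3) by (intro curve_length_join) (simp add: path_ends_join_path_list)
  also have "\<dots> \<le> ereal L + ereal (real (length (p' # ps)) * L)"
    by (intro add_mono 3) (use 3 in auto)
  finally show ?case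
    by (simp add: algebra_simps)
qed auto

text \<open>Chains of paths become powers of a relation, so that concatenation is addition of
  exponents and reversal is symmetry. The paths themselves are recovered only at the end.\<close>

definition step_relation ::
  "(real \<Rightarrow> 'a) set \<Rightarrow> 'a set \<Rightarrow> real \<Rightarrow> ('a::metric_space \<times> 'a) set" where
  "step_relation P B L = {(pathstart p, pathfinish p) | p.
     p \<in> P \<and> path_image p \<inter> B = {} \<and> curve_length 0 1 p \<le> ereal L}"

lemma sym_step_relation:
  assumes "\<And>p. p \<in> P \<Longrightarrow> reversepath p \<in> P"
  shows "sym (step_relation P B L)"
proof (rule symI)
  fix x y assume "(x, y) \<in> step_relation P B L"
  then obtain p where "p \<in> P" "path_image p \<inter> B = {}" "curve_length 0 1 p \<le> ereal L"
    "x = pathstart p" "y = pathfinish p"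
    by (auto simp: step_relation_def)
  with assms[of p] curve_length_reversepath[of p] show "(y, x) \<in> step_relation P B L"
    unfolding step_relation_def
    by (intro CollectI exI[of _ "reversepath p"]) auto
qed

lemma relpow_step_relation_imp_list:
  assumes "(x, y) \<in> step_relation P B L ^^ Suc N"
  shows "\<exists>ps. length ps = Suc N \<and> set ps \<subseteq> P \<and>
    successively (\<lambda>p p'. pathfinish p = pathstart p') ps \<and>
    pathstart (hd ps) = x \<and> pathfinish (last ps) = y \<and>
    (\<forall>p\<in>set ps. path_image p \<inter> B = {} \<and> curve_length 0 1 p \<le> ereal L)"
  using assms
proof (induction N arbitrary: x)
  case 0
  then obtain p where "p \<in> P" "path_image p \<inter> B = {}" "curve_length 0 1 p \<le> ereal L"
    "x = pathstart p" "y = pathfinish p"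
    by (auto simp: step_relation_def)
  then show ?case
    by (intro exI[of _ "[p]"]) auto
next
  case (Suc N)
  from relpow_Suc_D2[OF Suc.prems] obtain z
    where z: "(x, z) \<in> step_relation P B L" "(z, y) \<in> step_relation P B L ^^ Suc N" by blast
  from z(1) obtain p where "p \<in> P" "path_image p \<inter> B = {}" "curve_length 0 1 p \<le> ereal L"
    "x = pathstart p" "z = pathfinish p"
    by (auto simp: step_relation_def)
  moreover from Suc.IH[OF z(2)] obtain ps where "length ps = Suc N" "set ps \<subseteq> P"
    "successively (\<lambda>p p'. pathfinish p = pathstart p') ps"
    "pathstart (hd ps) = z" "pathfinish (last ps) = y"
    "\<forall>p\<in>set ps. path_image p \<inter> B = {} \<and> curve_length 0 1 p \<le> ereal L"
    by blast
  ultimately show ?case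
    by (intro exI[of _ "p # ps"]) (auto simp: successively_Cons)
qed

text \<open>Returns from relations to paths. A chain of length zero provides no path, hence
  \<open>1 \<le> N\<close>; the bound \<open>0 \<le> L\<close> lets the length estimate be relaxed
  from \<open>N\<close> to \<open>N'\<close>.\<close>

lemma relpow_step_relation_imp_polygonal_line:
  assumes "(x, y) \<in> step_relation P B L ^^ N" "1 \<le> N" "N \<le> N'" "0 \<le> L"
  shows "\<exists>p. polygonal_line N' P p \<and> pathstart p = x \<and> pathfinish p = y \<and>
    curve_length 0 1 p \<le> ereal (real N' * L) \<and> path_image p \<inter> B = {}"
proof -
  from \<open>1 \<le> N\<close> obtain M where M: "N = Suc M"
    by (cases N) auto
  from relpow_step_relation_imp_list[OF assms(1)[unfolded M]] obtain ps
    where ps: "length ps = N" "set ps \<subseteq> P"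
      "successively (\<lambda>p p'. pathfinish p = pathstart p') ps"
      "pathstart (hd ps) = x" "pathfinish (last ps) = y"
      "\<forall>p\<in>set ps. path_image p \<inter> B = {} \<and> curve_length 0 1 p \<le> ereal L"
    unfolding M by blast
  have ne: "ps \<noteq> []"
    using ps(1) M by auto
  have "curve_length 0 1 (join_path_list ps) \<le> ereal (real N * L)"
    using curve_length_join_path_list[OF ne ps(3), of L] ps(1,6) by auto
  also have "\<dots> \<le> ereal (real N' * L)"
    using assms by (simp add: mult_right_mono)
  finally show ?thesis
    using ps ne assms(3)
    by (intro exI[of _ "join_path_list ps"])
      (auto simp: polygonal_line_def path_ends_join_path_list path_image_join_path_list)
qed

text \<open>This makes the step relation symmetric, so that segments can be traversed either
  way.\<close>

lemma reversepath_combing_path_system: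
  assumes "p \<in> combing_path_system q T"
  shows "reversepath p \<in> combing_path_system q T"
proof -
  from assms obtain s t \<gamma> where st: "0 \<le> s" "s \<le> t" "t \<le> 1" "p = subsegment s t \<gamma>"
    and \<gamma>: "\<gamma> \<in> combing_lines q T \<union> reversepath ` combing_lines q T \<union> range (\<lambda>x _. x)"
    by (auto simp: combing_path_system_def)
  have "reversepath p = subsegment (1 - t) (1 - s) (reversepath \<gamma>)"
    by (auto simp: st reversepath_def subsegment_def fun_eq_iff algebra_simps)
  moreover have "reversepath \<gamma> \<in> combing_lines q T \<union> reversepath ` combing_lines q T \<union> range (\<lambda>x _. x)"
    using \<gamma> by (auto simp: reversepath_def[of "\<lambda>_. _"])
  ultimately show ?thesis
    using st unfolding combing_path_system_def
    by (intro CollectI exI[of _ "1 - t"] exI[of _ "1 - s"] exI[of _ "reversepath \<gamma>"]) auto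
qed

section \<open>Basic estimates for combing lines\<close>

locale quasi_consistent_bicombing =
  fixes q :: "'a::metric_space \<Rightarrow> 'a \<Rightarrow> real \<Rightarrow> 'a"
    and T :: "'a \<Rightarrow> 'a \<Rightarrow> real"
    and l k :: real
  assumes l_ge_1: "1 \<le> l" and k_nonneg: "0 \<le> k"
    and bicombing: "quasi_geodesic_bicombing l k q T"
    and bounded: "bounded_bicombing k q"
    and consistent: "quasi_consistent k q T"
begin

text \<open>The error of quasi-consistency for arbitrary subpaths, as in
  \<open>q_near_subpath\<close>: \<open>k + 1\<close> leads to a point of a maximal subpath, with
  \<open>1\<close> to spare for an infimum realised only approximately, and
  \<open>l * (l * k) + k\<close> pays for a time shift of at most \<open>l * k\<close>.\<close>

definition "c = l * (l * k) + 2 * k + 1"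
definition "k1 = l * (l + k)"
definition "k2 = (l * (2 * (l + k)) + 3) * (l + k)"

lemma k1_nonneg: "0 \<le> k1" and k2_nonneg: "0 \<le> k2"
  using l_ge_1 k_nonneg by (auto simp: k1_def k2_def)

lemma
  shows T_nonneg [simp]: "0 \<le> T x y"
    and q_0 [simp]: "q x y 0 = x"
    and q_T [simp]: "q x y (T x y) = y"
    and q_le_0: "t \<le> 0 \<Longrightarrow> q x y t = x"
    and q_ge_T: "T x y \<le> t \<Longrightarrow> q x y t = y"
  using bicombing unfolding quasi_geodesic_bicombing_def by auto

lemma q_improved: "improved_quasi_geodesic l k {0..T x y} (q x y)"
  using bicombing unfolding quasi_geodesic_bicombing_def by auto

lemma q_continuous: "continuous_on {0..T x y} (q x y)"
  using q_improved[of x y] by (simp add: improved_quasi_geodesic_def)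

lemma q_lower:
  assumes "s \<in> {0..T x y}" "t \<in> {0..T x y}"
  shows "\<bar>s - t\<bar> \<le> l * (dist (q x y s) (q x y t) + k)"
proof -
  have "\<bar>s - t\<bar> / l - k \<le> dist (q x y s) (q x y t)"
    using q_improved[of x y] assms
    unfolding improved_quasi_geodesic_def quasi_geodesic_def by blast
  then show ?thesis
    using l_ge_1 by (simp add: field_simps)
qed

lemma q_clamp: "q x y t = q x y (max 0 (min t (T x y)))"
  using q_le_0[of t x y] q_ge_T[of x y t] T_nonneg[of x y] by (auto simp: max_def min_def)

lemma q_in_image: obtains t' where "t' \<in> {0..T x y}" "q x y t = q x y t'"
  by (rule that[OF _ q_clamp]) auto

lemma q_upper: "dist (q x y s) (q x y t) \<le> l * \<bar>s - t\<bar> + k"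
proof -
  \<comment> \<open>Clamping times to the domain keeps the values and does not increase time
    differences, so the bound holds for all real times.\<close>
  define s' t' where "s' = max 0 (min s (T x y))" and "t' = max 0 (min t (T x y))"
  have "s' \<in> {0..T x y}" "t' \<in> {0..T x y}"
    by (auto simp: s'_def t'_def)
  then have "dist (q x y s') (q x y t') \<le> l * \<bar>s' - t'\<bar> + k"
    using q_improved[of x y] unfolding improved_quasi_geodesic_def quasi_geodesic_def by blast
  also have "\<bar>s' - t'\<bar> \<le> \<bar>s - t\<bar>"
    by (auto simp: s'_def t'_def)
  finally have "dist (q x y s') (q x y t') \<le> l * \<bar>s - t\<bar> + k"
    using l_ge_1 by (simp add: mult_left_mono)
  moreover have "q x y s = q x y s'" "q x y t = q x y t'"
    unfolding s'_def t'_def by (rule q_clamp)+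
  ultimately show ?thesis
    by (simp only:)
qed

lemma q_length:
  assumes "0 \<le> s" "s \<le> t" "t \<le> T x y"
  shows "curve_length s t (q x y) \<le> ereal (k1 * dist (q x y s) (q x y t) + k2)"
  using q_improved[of x y] assms
  unfolding improved_quasi_geodesic_def Let_def k1_def k2_def by auto

lemma q_bounded: "dist (q x y t) (q x' y' t) \<le> k * (dist x x' + dist y y') + k"
  using bounded by (simp add: bounded_bicombing_def)

text \<open>The lower bound at the two ends bounds the duration \<open>T x y\<close>, and the upper
  bound then bounds the excursion. A combing line between close points thus stays near its
  start.\<close>

lemma q_near_start: "dist x (q x y t) \<le> l * (l * (dist x y + k)) + k"
proof -
  obtain t' where t': "t' \<in> {0..T x y}" "q x y t = q x y t'"
    by (rule q_in_image)
  have "t' \<le> l * (dist x y + k)"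
    using t' q_lower[of 0 x y "T x y"] by auto
  then have "l * t' \<le> l * (l * (dist x y + k))"
    using l_ge_1 by (simp add: mult_left_mono)
  then show ?thesis
    using q_upper[of x y 0 t'] t' by simp
qed

lemma combing_segment:
  assumes "0 \<le> s" "s \<le> t" "t \<le> T x y"
  obtains p where "p \<in> combing_path_system q T" "pathstart p = q x y s" "pathfinish p = q x y t"
    "path_image p = q x y ` {s..t}"
    "curve_length 0 1 p \<le> ereal (k1 * dist (q x y s) (q x y t) + k2)"
proof -
  define p where "p u = q x y ((t - s) * u + s)" for u
  \<comment> \<open>If \<open>T x y = 0\<close>, then \<open>s = t = 0\<close> and division by zero
    gives \<open>0\<close>, so the identities \<open>st\<close> persist.\<close>
  define s' t' where "s' = s / T x y" and "t' = t / T x y"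
  have st: "T x y * s' = s" "T x y * t' = t"
    using assms by (auto simp: s'_def t'_def)
  have st': "0 \<le> s'" "s' \<le> t'" "t' \<le> 1"
    using assms T_nonneg[of x y] by (auto simp: s'_def t'_def divide_simps)
  have "p = subsegment s' t' (subsegment 0 (T x y) (q x y))"
  proof
    fix u
    have "T x y * ((t' - s') * u + s') = (T x y * t' - T x y * s') * u + T x y * s'"
      by (simp add: algebra_simps)
    then have "T x y * ((t' - s') * u + s') = (t - s) * u + s"
      by (simp only: st)
    then show "p u = subsegment s' t' (subsegment 0 (T x y) (q x y)) u"
      by (simp add: p_def subsegment_def)
  qed
  then have "p \<in> combing_path_system q T"
    unfolding combing_path_system_def combing_lines_def using st' by blast
  moreover have "path_image p = q x y ` {s..t}"
  proof -
    have "(\<lambda>u. (t - s) * u + s) ` {0..1} = {s..t}"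
      using assms image_affinity_atLeastAtMost[of "t - s" s 0 1] by auto
    then show ?thesis
      unfolding path_image_def p_def by (metis image_image)
  qed
  moreover have "curve_length 0 1 p \<le> curve_length s t (q x y)"
  proof (rule curve_length_reparam_mono[where \<phi> = "\<lambda>u. (t - s) * u + s"])
    fix u :: real assume "0 \<le> u" "u \<le> 1"
    then have "0 \<le> (t - s) * u" "(t - s) * u \<le> (t - s) * 1"
      using assms by (auto intro!: mult_left_mono simp del: mult_1_right)
    then show "s \<le> (t - s) * u + s \<and> (t - s) * u + s \<le> t \<and> p u = q x y ((t - s) * u + s)"
      by (simp add: p_def)
  qed (use assms in \<open>simp add: mult_left_mono\<close>)
  ultimately show ?thesis
    using q_length[OF assms] that[of p] by (auto simp: p_def pathstart_def pathfinish_def)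
qed

section \<open>Subpaths and quasi-consistency\<close>

text \<open>Quasi-consistency speaks only of maximal subpaths. By continuity, the admissible pairs
  of times around \<open>s\<close> and \<open>t\<close> form a compact set, on which the duration
  attains its maximum.\<close>

lemma maximal_subpath_exists:
  assumes "subpath_between (q x y) (T x y) z1 z2 s t"
  obtains s' t' where "s' \<le> s" "t \<le> t'" "maximal_subpath_between (q x y) (T x y) z1 z2 s' t'"
proof -
  have st: "0 \<le> s" "s \<le> t" "t \<le> T x y"
    using assms by (auto simp: subpath_between_def)
  define A B where "A z = {u \<in> {0..s}. q x y u = z}" and "B z = {u \<in> {t..T x y}. q x y u = z}" for z
  have closed: "compact {u \<in> {a..b}. q x y u = z}" if "0 \<le> a" "b \<le> T x y" for a b z
  proof -
    have "closed {u \<in> {a..b}. q x y u = z}"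
      by (intro continuous_closed_preimage_constant continuous_on_subset[OF q_continuous])
        (use that in auto)
    moreover have "bounded {u \<in> {a..b}. q x y u = z}"
      by (rule bounded_subset[OF bounded_closed_interval]) auto
    ultimately show ?thesis
      by (simp add: compact_eq_bounded_closed)
  qed
  have "compact (A z)" "compact (B z)" for z
    unfolding A_def B_def using st by (auto intro!: closed simp del: atLeastAtMost_iff)
  \<comment> \<open>One product for each order in which the two points are visited.\<close>
  define K where "K = A z1 \<times> B z2 \<union> A z2 \<times> B z1"
  have "compact K"
    unfolding K_def by (intro compact_Un compact_Times) fact+
  moreover have "(s, t) \<in> K"
    using assms by (auto simp: K_def A_def B_def subpath_between_def)
  moreover have "continuous_on K (\<lambda>p. snd p - fst p)"
    by (intro continuous_intros)
  ultimately obtain z where z: "z \<in> K" "\<forall>p\<in>K. snd p - fst p \<le> snd z - fst z"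
    using continuous_attains_sup[of K "\<lambda>p. snd p - fst p"] by blast
  obtain s' t' where "z = (s', t')"
    by (cases z)
  with z have m: "(s', t') \<in> K" "\<And>a b. (a, b) \<in> K \<Longrightarrow> b - a \<le> t' - s'"
    by force+
  have "maximal_subpath_between (q x y) (T x y) z1 z2 s' t'"
    unfolding maximal_subpath_between_def
  proof (intro conjI allI impI)
    show "subpath_between (q x y) (T x y) z1 z2 s' t'"
      using m(1) st by (auto simp: K_def A_def B_def subpath_between_def)
    fix a b assume ab: "subpath_between (q x y) (T x y) z1 z2 a b \<and> {s'..t'} \<subseteq> {a..b}"
    have "s' \<le> t'"
      using m(1) st by (auto simp: K_def A_def B_def)
    then have le: "a \<le> s'" "t' \<le> b"
      using ab by auto
    have "(a, b) \<in> K"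
      using ab le m(1) by (auto simp: K_def A_def B_def subpath_between_def)
    from m(2)[OF this] le show "a = s'" "b = t'"
      by auto
  qed
  moreover have "s' \<le> s" "t \<le> t'"
    using m(1) by (auto simp: K_def A_def B_def)
  ultimately show ?thesis
    by (rule that[rotated 2])
qed

text \<open>A maximal subpath around the given one overshoots it only slightly in time, since its
  ends revisit the same two points. The point supplied by quasi-consistency can therefore be moved
  back into \<open>{s..t}\<close>.\<close>

lemma q_near_subpath:
  assumes "subpath_between (q x y) (T x y) z1 z2 s t"
  obtains p where "p \<in> {s..t}" "dist (q z1 z2 r) (q x y p) \<le> c"
proof -
  obtain s' t' where st': "s' \<le> s" "t \<le> t'" "maximal_subpath_between (q x y) (T x y) z1 z2 s' t'"
    using maximal_subpath_exists[OF assms] by blast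
  have st: "0 \<le> s" "s \<le> t" "t \<le> T x y"
    and z: "q x y s = z1 \<and> q x y t = z2 \<or> q x y s = z2 \<and> q x y t = z1"
    using assms by (auto simp: subpath_between_def)
  have s't': "0 \<le> s'" "s' \<le> t'" "t' \<le> T x y"
    and z': "q x y s' = z1 \<and> q x y t' = z2 \<or> q x y s' = z2 \<and> q x y t' = z1"
    using st'(3) by (auto simp: maximal_subpath_between_def subpath_between_def)
  have "z1 \<in> q x y ` {0..T x y}" "z2 \<in> q x y ` {0..T x y}"
    using z st by auto
  then have "hausdorff_distance (q x y ` {s'..t'}) (q z1 z2 ` {0..T z1 z2}) \<le> ereal k"
    using consistent st'(3) unfolding quasi_consistent_def by blast
  then have *: "infdist w (q x y ` {s'..t'}) \<le> k" if "w \<in> q z1 z2 ` {0..T z1 z2}" for w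
    using that unfolding hausdorff_distance_def by (auto simp: SUP_le_iff)
  obtain r' where "r' \<in> {0..T z1 z2}" "q z1 z2 r = q z1 z2 r'"
    by (rule q_in_image)
  then have "infdist (q z1 z2 r) (q x y ` {s'..t'}) < k + 1"
    using *[of "q z1 z2 r"] by auto
  moreover have ne: "q x y ` {s'..t'} \<noteq> {}"
    using s't' by auto
  ultimately obtain p' where p': "p' \<in> {s'..t'}" "dist (q z1 z2 r) (q x y p') < k + 1"
    by (auto simp: infdist_def cINF_less_iff)
  have close: "\<bar>a - b\<bar> \<le> l * k" if "a \<in> {0..T x y}" "b \<in> {0..T x y}" "q x y a = q x y b" for a b
    using q_lower[OF that(1,2)] that(3) by simp
  \<comment> \<open>The two subpaths may visit \<open>z1\<close> and \<open>z2\<close> in opposite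
    orders; then \<open>s\<close> is compared with \<open>t'\<close>, and \<open>t\<close> with
    \<open>s'\<close>.\<close>
  have "p' \<le> t + l * k \<and> s - l * k \<le> p'"
    using close[of s s'] close[of t t'] close[of s t'] close[of t s'] z z' st s't' st' p' by auto
  moreover define p where "p = max s (min t p')"
  ultimately have "\<bar>p' - p\<bar> \<le> l * k" "p \<in> {s..t}"
    using st mult_nonneg_nonneg[of l k] l_ge_1 k_nonneg by (auto simp: max_def min_def)
  then have "l * \<bar>p' - p\<bar> \<le> l * (l * k)"
    using l_ge_1 by (simp add: mult_left_mono)
  then have "dist (q x y p') (q x y p) \<le> l * (l * k) + k"
    using q_upper[of x y p' p] by simp
  then have "dist (q z1 z2 r) (q x y p) \<le> c"
    using p'(2) dist_triangle[of "q z1 z2 r" "q x y p" "q x y p'"] by (simp add: c_def)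
  with \<open>p \<in> {s..t}\<close> show ?thesis
    by (rule that)
qed

text \<open>Distance from \<open>m\<close> is known for the pieces of a polygonal line, while
  boundedness applies to combing lines; this transfers information from the former to the
  latter.\<close>

lemma q_near_combing_path:
  assumes "p \<in> combing_path_system q T"
  obtains z where "z \<in> path_image p" "dist (q (pathstart p) (pathfinish p) r) z \<le> c"
proof -
  from assms obtain s t \<gamma> where st: "0 \<le> s" "s \<le> t" "t \<le> 1" "p = subsegment s t \<gamma>"
    and \<gamma>: "\<gamma> \<in> combing_lines q T \<union> reversepath ` combing_lines q T \<union> range (\<lambda>x _. x)"
    by (auto simp: combing_path_system_def)
  have ends: "pathstart p = \<gamma> s" "pathfinish p = \<gamma> t"
    by (auto simp: st pathstart_def pathfinish_def subsegment_def)
  have "(\<lambda>u. (t - s) * u + s) ` {0..1} = {s..t}"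
    using st image_affinity_atLeastAtMost[of "t - s" s 0 1] by auto
  then have im: "path_image p = \<gamma> ` {s..t}"
    unfolding path_image_def st subsegment_def by (metis image_image)
  consider x y where "\<gamma> = subsegment 0 (T x y) (q x y)"
    | x y where "\<gamma> = reversepath (subsegment 0 (T x y) (q x y))"
    | x where "\<gamma> = (\<lambda>_. x)"
    using \<gamma> by (auto simp: combing_lines_def)
  then show ?thesis
  proof cases
    case (1 x y)
    then have \<gamma>: "\<gamma> u = q x y (T x y * u)" for u
      by (simp add: subsegment_def)
    have "subpath_between (q x y) (T x y) (pathstart p) (pathfinish p) (T x y * s) (T x y * t)"
      using st(1-3) by (auto simp: subpath_between_def ends \<gamma> mult_left_le intro!: mult_left_mono)
    from q_near_subpath[OF this, of r] obtain v where v: "v \<in> {T x y * s..T x y * t}"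
      "dist (q (pathstart p) (pathfinish p) r) (q x y v) \<le> c" by blast
    moreover have "v \<in> (\<lambda>u. T x y * u) ` {s..t}"
      using v(1) st(1-3) T_nonneg[of x y, unfolded le_less]
      by (auto simp: image_mult_atLeastAtMost_if)
    ultimately show ?thesis
      using that by (auto simp: im \<gamma>)
  next
    case (2 x y)
    then have \<gamma>: "\<gamma> u = q x y (T x y * (1 - u))" for u
      by (simp add: subsegment_def reversepath_def)
    \<comment> \<open>\<open>subpath_between\<close> admits both orders of the ends, so a reversed
      segment is covered with its times reflected.\<close>
    have "subpath_between (q x y) (T x y) (pathstart p) (pathfinish p)
        (T x y * (1 - t)) (T x y * (1 - s))"
      using st(1-3) by (auto simp: subpath_between_def ends \<gamma> mult_left_le intro!: mult_left_mono)
    from q_near_subpath[OF this, of r] obtain v where v: "v \<in> {T x y * (1 - t)..T x y * (1 - s)}"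
      "dist (q (pathstart p) (pathfinish p) r) (q x y v) \<le> c" by blast
    moreover have "v \<in> (\<lambda>u. T x y * u) ` {1 - t..1 - s}"
      using v(1) st(1-3) T_nonneg[of x y, unfolded le_less]
      by (auto simp: image_mult_atLeastAtMost_if)
    then obtain u where "u \<in> {1 - t..1 - s}" "v = T x y * u"
      by blast
    then have "1 - u \<in> {s..t}" "\<gamma> (1 - u) = q x y v"
      by (auto simp: \<gamma>)
    ultimately show ?thesis
      using that by (metis im image_eqI)
  next
    case (3 x)
    \<comment> \<open>The line \<open>q x x\<close> need not be constant, but its excursion from
      \<open>x\<close> is at most \<open>l * (l * k) + k\<close>.\<close>
    have "dist x (q x x r) \<le> c"
      using q_near_start[of x x r] k_nonneg by (simp add: c_def)
    moreover have "x \<in> path_image p"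
      using st(1-3) by (simp add: im 3 image_constant_conv)
    ultimately show ?thesis
      by (intro that) (simp_all add: ends 3 dist_commute)
  qed
qed

end

section \<open>Constants and rays at scale \<open>R\<close>\<close>

text \<open>The lower bounds on \<open>R\<close> absorb the additive errors: those of
  quasi-consistency and of the quasi-geodesic inequality, and the drift of a combing line whose end
  moves one time unit along a ray.\<close>

locale bicombing_at_scale = quasi_consistent_bicombing q T l k
  for q :: "'a::metric_space \<Rightarrow> 'a \<Rightarrow> real \<Rightarrow> 'a" and T l k +
  fixes m :: 'a and R :: real
  assumes R_ge_1: "1 \<le> R" and R_ge_c: "4 * c \<le> R"
    and R_ge_drift: "8 * (k * (l + k) + k) \<le> R" and R_ge_k: "16 * (l * l) * k \<le> R"
begin

text \<open>A ray that lasts until time \<tau> is then at distance at least \<open>K * R - k\<close>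
  from \<open>m\<close>. The summands of \<open>K\<close> pay for the passage to a nearby line, at
  most \<open>(k + 1) * R\<close>, and for the excursion of a connecting combing line, at most
  \<open>l * l * (k + 1) * R + k\<close>. The ends of all steps used lie within \<open>M * R\<close>
  of \<open>m\<close>.\<close>

definition "K = l * l * (k + 1) + k + 4"
definition "\<tau> = l * K * R"
definition "M = l * l * K + k + 4"
text \<open>Half of \<open>R / (16 * (l * l))\<close>, the distance from \<open>m\<close> that a ray
  keeps from time \<open>R / (8 * l)\<close> on.\<close>

definition "\<rho> = R / (32 * (l * l))"
definition "S = step_relation (combing_path_system q T) (cball m \<rho>) ((2 * k1 * M + k2) * R)"
definition "\<pi> x = q m x (min \<tau> (T m x))"

lemma l_sq_ge_1: "1 \<le> l * l"
  using l_ge_1 mult_mono[of 1 l 1 l] by simp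

lemma k_le: "k \<le> R / 16"
  using R_ge_k l_sq_ge_1 k_nonneg mult_right_mono[of 1 "l * l" k] by auto

lemma c_ge: "1 \<le> c" "2 * k \<le> c"
  using l_ge_1 k_nonneg by (auto simp: c_def)

lemma K_ge: "4 \<le> K"
  using l_ge_1 k_nonneg by (auto simp: K_def)

lemma M_ge: "4 \<le> M"
  using l_ge_1 k_nonneg K_ge by (auto simp: M_def)

lemma M_bound: "l * \<tau> + k + (k + 3) * R \<le> M * R"
  using k_le R_ge_1 by (simp add: M_def \<tau>_def algebra_simps)

lemma tau_ge: "R \<le> \<tau>"
proof -
  have "1 * R \<le> (l * K) * R"
    using l_ge_1 K_ge R_ge_1 mult_mono[of 1 l 1 K] by (intro mult_right_mono) auto
  then show ?thesis
    by (simp add: \<tau>_def)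
qed

lemma sym_S: "sym S"
  unfolding S_def by (intro sym_step_relation reversepath_combing_path_system)

lemma S_segment_le:
  assumes "0 \<le> s" "s \<le> t" "t \<le> T x y"
    and "\<And>p. p \<in> {s..t} \<Longrightarrow> \<rho> < dist m (q x y p)"
    and "dist m (q x y s) \<le> M * R" "dist m (q x y t) \<le> M * R"
  shows "(q x y s, q x y t) \<in> S"
proof -
  obtain p where p: "p \<in> combing_path_system q T" "pathstart p = q x y s" "pathfinish p = q x y t"
    "path_image p = q x y ` {s..t}"
    "curve_length 0 1 p \<le> ereal (k1 * dist (q x y s) (q x y t) + k2)"
    using combing_segment[OF assms(1-3)] .
  have "dist (q x y s) (q x y t) \<le> 2 * M * R"
    using assms(5,6) dist_triangle[of "q x y s" "q x y t" m] by (simp add: dist_commute)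
  then have "k1 * dist (q x y s) (q x y t) \<le> k1 * (2 * M * R)"
    using k1_nonneg by (rule mult_left_mono)
  moreover have "k2 \<le> k2 * R"
    using R_ge_1 k2_nonneg mult_left_mono[of 1 R k2] by simp
  ultimately have "k1 * dist (q x y s) (q x y t) + k2 \<le> (2 * k1 * M + k2) * R"
    by (simp add: algebra_simps)
  then have "curve_length 0 1 p \<le> ereal ((2 * k1 * M + k2) * R)"
    using p(5) by (meson ereal_less_eq(3) order_trans)
  moreover have "q x y u \<notin> cball m \<rho>" if "u \<in> {s..t}" for u
    using assms(4)[OF that] by simp
  then have "path_image p \<inter> cball m \<rho> = {}"
    unfolding p(4) by blast
  ultimately show ?thesis
    unfolding S_def step_relation_def using p(1-3) by (intro CollectI exI[of _ p]) simp
qed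

text \<open>Distance from \<open>m\<close> is asked for at all times from \<open>min s t\<close> on,
  which is how it is known along a ray; symmetry covers both orders of \<open>s\<close> and
  \<open>t\<close>.\<close>

lemma S_segment:
  assumes "s \<in> {0..T x y}" "t \<in> {0..T x y}"
    and "\<And>p. p \<in> {0..T x y} \<Longrightarrow> min s t \<le> p \<Longrightarrow> \<rho> < dist m (q x y p)"
    and "dist m (q x y s) \<le> M * R" "dist m (q x y t) \<le> M * R"
  shows "(q x y s, q x y t) \<in> S"
proof (cases "s \<le> t")
  case True
  then show ?thesis
    using assms by (intro S_segment_le) auto
next
  case False
  then have "(q x y t, q x y s) \<in> S"
    using assms by (intro S_segment_le) auto
  then show ?thesis
    using sym_S by (rule symD[rotated])
qed

lemma dist_ray_le: "p \<ge> 0 \<Longrightarrow> dist m (q m x p) \<le> l * p + k"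
  using q_upper[of m x 0 p] by simp

lemma dist_ray_ge: "p \<in> {0..T m x} \<Longrightarrow> p \<le> l * (dist m (q m x p) + k)"
  using q_lower[of 0 m x p] by simp

text \<open>Together with \<open>ray_time\<close>: a ray that has reached distance
  \<open>R / 4\<close> from \<open>m\<close> never returns to the ball of radius \<rho>.\<close>

lemma ray_far:
  assumes "p \<in> {0..T m x}" "R / (8 * l) \<le> p"
  shows "\<rho> < dist m (q m x p)"
proof -
  have "R / (8 * l) \<le> l * (dist m (q m x p) + k)"
    using assms dist_ray_ge[of p x] by linarith
  then have "R \<le> 8 * (l * l) * (dist m (q m x p) + k)"
    using l_ge_1 by (simp add: field_simps)
  then have "R / 2 \<le> 8 * (l * l) * dist m (q m x p)"
    using R_ge_k by (simp add: algebra_simps)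
  then have "R / (16 * (l * l)) \<le> dist m (q m x p)"
    using l_sq_ge_1 l_ge_1 by (simp add: field_simps)
  moreover have "\<rho> < R / (16 * (l * l))"
    using R_ge_1 l_ge_1 unfolding \<rho>_def by (simp add: field_simps)
  ultimately show ?thesis
    by simp
qed

lemma ray_time:
  assumes "p \<ge> 0" "R / 4 \<le> dist m (q m x p)"
  shows "R / (8 * l) \<le> p"
proof -
  have "R / 8 \<le> l * p"
    using dist_ray_le[OF assms(1), of x] assms(2) k_le R_ge_1 by linarith
  then show ?thesis
    using l_ge_1 by (simp add: field_simps)
qed

lemma projection:
  assumes "R \<le> dist m x"
  shows "R / (8 * l) \<le> min \<tau> (T m x)" "min \<tau> (T m x) \<in> {0..T m x}" "dist m (\<pi> x) \<le> M * R"
proof -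
  have "R / (8 * l) \<le> R / 1"
    using R_ge_1 l_ge_1 by (intro divide_left_mono) auto
  moreover have "R / (8 * l) \<le> T m x"
    using assms R_ge_1 ray_time[of "T m x" x] by simp
  ultimately show "R / (8 * l) \<le> min \<tau> (T m x)"
    using tau_ge by simp
  show le: "min \<tau> (T m x) \<in> {0..T m x}"
    using tau_ge R_ge_1 by auto
  have "dist m (\<pi> x) \<le> l * min \<tau> (T m x) + k"
    using dist_ray_le[of "min \<tau> (T m x)" x] le by (simp add: \<pi>_def)
  also have "\<dots> \<le> l * \<tau> + k"
    using l_ge_1 by simp
  also have "\<dots> \<le> M * R"
    using M_bound k_nonneg R_ge_1 mult_nonneg_nonneg[of "k + 3" R] by linarith
  finally show "dist m (\<pi> x) \<le> M * R" .
qed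

lemma S_ray:
  assumes "R \<le> dist m x" "s \<in> {0..T m x}" "R / 4 \<le> dist m (q m x s)" "dist m (q m x s) \<le> M * R"
  shows "(q m x s, \<pi> x) \<in> S"
  unfolding \<pi>_def
proof (rule S_segment)
  show "\<rho> < dist m (q m x p)"
    if "p \<in> {0..T m x}" "min s (min \<tau> (T m x)) \<le> p" for p
    using that projection(1)[OF assms(1)] ray_time[OF _ assms(3)] assms(2)
    by (intro ray_far) auto
qed (use assms projection[OF assms(1)] in \<open>auto simp: \<pi>_def\<close>)

section \<open>Passing from a combing line near \<open>m\<close> to a ray\<close>

lemma rho_less: "\<rho> < R / 4"
  using R_ge_1 l_sq_ge_1 unfolding \<rho>_def by (intro divide_strict_left_mono) auto

text \<open>
  Here \<open>q x y v\<close> plays the role of \<open>u\<close> and \<open>q x y e\<close> that of \<open>w\<close> (or of \<open>a\<close>, when \<open>b = a\<close> and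
  \<open>e = 0\<close>).  If the ray from \<open>m\<close> to \<open>w\<close> is shorter than \<open>\<tau>\<close>, then \<open>w\<close> itself is the point sought.
\<close>

lemma crossing:
  assumes v: "v \<in> {0..T x y}" and u: "dist m (q x y v) \<le> R / 2"
    and far: "\<And>t. R / 4 \<le> dist m (q x y t)"
    and e: "e = 0 \<or> e = T x y" and s: "s \<in> {0..T m b}" and w: "q x y e = q m b s"
  obtains t s' where "t \<in> {0..T x y}" "s' \<in> {0..T m b}" "(q x y t, q m b s') \<in> S"
    "R / 4 \<le> dist m (q m b s')" "dist m (q x y t) \<le> M * R" "dist m (q m b s') \<le> M * R"
proof (cases "T m (q m b s) < \<tau>")
  case True
  let ?w = "q m b s"
  have "dist m ?w \<le> l * T m ?w + k"
    using dist_ray_le[of "T m ?w" ?w] by simp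
  also have "\<dots> \<le> l * \<tau> + k"
    using True l_ge_1 by simp
  also have "\<dots> \<le> M * R"
    using M_bound k_nonneg R_ge_1 mult_nonneg_nonneg[of "k + 3" R] by linarith
  finally have near: "dist m ?w \<le> M * R" .
  have e': "e \<in> {0..T x y}"
    using e by auto
  have "\<rho> < dist m (q x y p)" for p
    using far[of p] rho_less by linarith
  then have "(q x y e, q x y e) \<in> S"
    using e' near w by (intro S_segment) auto
  then show ?thesis
    using that[OF e' s] far[of e] near w by simp
next
  case False
  let ?w = "q m b s" and ?u = "q x y v"
  \<comment> \<open>Moving the start from \<open>m\<close> to \<open>?u\<close> costs
    \<open>k * (R / 2) + k\<close> by boundedness; passing to the line from \<open>x\<close> to
    \<open>y\<close> costs \<open>c\<close> by quasi-consistency.\<close>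
  define D where "D = k * (R / 2) + k + c"
  have sub: "subpath_between (q x y) (T x y) ?u ?w (min v e) (max v e)"
    using v e w by (auto simp: subpath_between_def min_def max_def)
  obtain t where t: "t \<in> {min v e..max v e}" "dist (q ?u ?w \<tau>) (q x y t) \<le> c"
    using q_near_subpath[OF sub] by blast
  have t': "t \<in> {0..T x y}"
    using t v e by auto
  \<comment> \<open>As \<open>?w\<close> lies on the ray to \<open>b\<close>, quasi-consistency puts
    the ray to \<open>?w\<close> at time \<tau> near the ray to \<open>b\<close>.\<close>
  have "subpath_between (q m b) (T m b) m ?w 0 s"
    using s by (auto simp: subpath_between_def)
  then obtain s' where s': "s' \<in> {0..s}" "dist (q m ?w \<tau>) (q m b s') \<le> c"
    by (rule q_near_subpath)
  have "dist (q m ?w \<tau>) (q ?u ?w \<tau>) \<le> k * dist m ?u + k"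
    using q_bounded[of m ?w \<tau> ?u ?w] by simp
  also have "\<dots> \<le> k * (R / 2) + k"
    using mult_left_mono[OF u k_nonneg] by simp
  finally have d1: "dist (q m ?w \<tau>) (q x y t) \<le> D"
    using t(2) dist_triangle[of "q m ?w \<tau>" "q x y t" "q ?u ?w \<tau>"] by (simp add: D_def)
  have kR: "0 \<le> k * R"
    using k_nonneg R_ge_1 by simp
  have D: "D \<le> (k + 1) * R" "D + c + k \<le> (k + 1) * R"
    using kR k_le R_ge_c c_ge R_ge_1 by (auto simp: D_def algebra_simps)
  have far_tau: "K * R - k \<le> dist m (q m ?w \<tau>)"
  proof -
    have "\<tau> \<le> l * (dist m (q m ?w \<tau>) + k)"
      using False tau_ge R_ge_1 by (intro dist_ray_ge) auto
    then have "l * (K * R) \<le> l * (dist m (q m ?w \<tau>) + k)"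
      by (simp add: \<tau>_def)
    then show ?thesis
      using l_ge_1 by simp
  qed
  have near_tau: "dist m (q m ?w \<tau>) \<le> l * \<tau> + k"
    using tau_ge R_ge_1 by (intro dist_ray_le) auto
  let ?z = "q x y t" and ?z' = "q m b s'"
  have KR: "K * R = l * l * ((k + 1) * R) + (k + 1) * R + 3 * R"
    by (simp add: K_def algebra_simps)
  have *: "0 \<le> l * l * ((k + 1) * R)"
    using l_ge_1 k_nonneg R_ge_1 by simp
  have z: "dist m ?z \<le> M * R" "K * R - k - (k + 1) * R \<le> dist m ?z"
    using d1 near_tau far_tau M_bound D(1) R_ge_1
      dist_triangle[of m ?z "q m ?w \<tau>"] dist_triangle[of m "q m ?w \<tau>" ?z]
    by (auto simp: dist_commute algebra_simps)
  have z': "dist m ?z' \<le> M * R" "R / 4 \<le> dist m ?z'"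
  proof -
    show "dist m ?z' \<le> M * R"
      using s'(2) near_tau M_bound R_ge_c R_ge_1 c_ge kR dist_triangle[of m ?z' "q m ?w \<tau>"]
      by (auto simp: algebra_simps)
    show "R / 4 \<le> dist m ?z'"
      using s'(2) far_tau R_ge_c R_ge_1 c_ge kR KR * k_le
        dist_triangle[of m "q m ?w \<tau>" ?z']
      by (auto simp: dist_commute algebra_simps)
  qed
  have zz: "dist ?z ?z' \<le> D + c"
    using d1 s'(2) dist_triangle[of ?z ?z' "q m ?w \<tau>"] by (simp add: dist_commute)
  \<comment> \<open>Subtracting the excursion of the connecting line from the distance of
    \<open>?z\<close> to \<open>m\<close> still leaves at least \<open>3 * R - 2 * k\<close>, by the
    choice of \<open>K\<close>.\<close>
  have "\<rho> < dist m (q ?z ?z' p)" for p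
  proof -
    have "dist ?z (q ?z ?z' p) \<le> l * (l * (dist ?z ?z' + k)) + k"
      by (rule q_near_start)
    also have "\<dots> \<le> l * (l * ((k + 1) * R)) + k"
      using zz D(2) l_ge_1 by (intro add_right_mono mult_left_mono) auto
    finally have "dist m ?z \<le> dist m (q ?z ?z' p) + l * l * ((k + 1) * R) + k"
      using dist_triangle[of m ?z "q ?z ?z' p"] by (simp add: dist_commute)
    then show ?thesis
      using z(2) KR k_le R_ge_1 rho_less by linarith
  qed
  then have "(q ?z ?z' 0, q ?z ?z' (T ?z ?z')) \<in> S"
    using z z' by (intro S_segment) auto
  then show ?thesis
    using that[OF t', of s'] s s' z z' by auto
qed

text \<open>Three steps: along the combing line away from \<open>m\<close>, across to the ray, and
  along the ray to its projection point.\<close>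

lemma crossing_to_projection:
  assumes v: "v \<in> {0..T x y}" and u: "dist m (q x y v) \<le> R / 2"
    and far: "\<And>t. R / 4 \<le> dist m (q x y t)"
    and e: "e = 0 \<or> e = T x y" and s: "s \<in> {0..T m b}" and w: "q x y e = q m b s"
    and b: "R \<le> dist m b"
  shows "(q x y v, \<pi> b) \<in> S ^^ 3" "(\<pi> b, q x y v) \<in> S ^^ 3"
proof -
  obtain t s' where t: "t \<in> {0..T x y}" and s': "s' \<in> {0..T m b}" "R / 4 \<le> dist m (q m b s')"
      "dist m (q m b s') \<le> M * R"
    and 2: "(q x y t, q m b s') \<in> S" and near: "dist m (q x y t) \<le> M * R"
    using crossing[OF v u far e s w] by blast
  have "dist m (q x y v) \<le> M * R"
    using u R_ge_1 M_ge mult_right_mono[of 4 M R] by linarith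
  moreover have "\<rho> < dist m (q x y p)" for p
    using far[of p] rho_less by linarith
  ultimately have 1: "(q x y v, q x y t) \<in> S"
    using v t near by (intro S_segment) auto
  have 3: "(q m b s', \<pi> b) \<in> S"
    using S_ray b s' by blast
  show "(q x y v, \<pi> b) \<in> S ^^ 3" "(\<pi> b, q x y v) \<in> S ^^ 3"
    using 1 2 3 sym_S by (auto simp: numeral_3_eq_3 dest: symD)
qed

section \<open>Projecting combing lines, pieces and polygonal lines\<close>

lemma far_line_projection:
  assumes a: "R \<le> dist m a" and b: "R \<le> dist m b" and ab: "\<And>t. R / 2 < dist m (q a b t)"
  shows "(\<pi> a, \<pi> b) \<in> S ^^ 6"
proof -
  \<comment> \<open>The end slides from \<open>b\<close> in unit time steps; by the constant
    extension it reaches \<open>m\<close>, where the line certainly meets the ball of radius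
    \<open>R / 2\<close>.\<close>
  define w where "w j = q m b (T m b - real j)" for j
  define near where "near j \<longleftrightarrow> (\<exists>t. dist m (q a (w j) t) \<le> R / 2)" for j
  obtain N where "T m b \<le> real N"
    using real_arch_simple by blast
  then have "w N = m"
    by (simp add: w_def q_le_0)
  then have "near N"
    unfolding near_def using R_ge_1 by (intro exI[of _ "T a m"]) auto
  define j where "j = (LEAST j. near j)"
  have "near j"
    unfolding j_def by (rule LeastI) fact
  have "\<not> near 0"
    using ab by (auto simp: near_def w_def not_le)
  with \<open>near j\<close> obtain i where i: "j = Suc i"
    by (cases j) auto
  then have "\<not> near i"
    unfolding j_def using not_less_Least[of i near] by simp
  \<comment> \<open>The previous line avoids the ball of radius \<open>R / 2\<close>, and one time
    step moves every point of the line by at most \<open>R / 8\<close>.\<close>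
  have far: "R / 4 \<le> dist m (q a (w j) t)" for t
  proof -
    have "dist (w i) (w j) \<le> l + k"
      using q_upper[of m b "T m b - real i" "T m b - real j"] by (simp add: w_def i)
    then have "k * dist (w i) (w j) \<le> k * (l + k)"
      using k_nonneg by (rule mult_left_mono)
    then have "dist (q a (w i) t) (q a (w j) t) \<le> R / 8"
      using q_bounded[of a "w i" t a "w j"] R_ge_drift by simp
    moreover have "R / 2 < dist m (q a (w i) t)"
      using \<open>\<not> near i\<close> by (auto simp: near_def not_le)
    ultimately show ?thesis
      using R_ge_1 dist_triangle[of m "q a (w i) t" "q a (w j) t"] by (simp add: dist_commute)
  qed
  obtain v where v: "v \<in> {0..T a (w j)}" "dist m (q a (w j) v) \<le> R / 2"
    using \<open>near j\<close> q_in_image unfolding near_def by metis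
  \<comment> \<open>This makes \<open>T m b - real j\<close> a genuine time of the ray to
    \<open>b\<close>, not one from the constant extension.\<close>
  have "w j \<noteq> m"
    using far[of "T a (w j)"] R_ge_1 by auto
  then have "\<not> T m b - real j \<le> 0"
    using q_le_0[of "T m b - real j" m b] by (auto simp: w_def)
  then have s: "T m b - real j \<in> {0..T m b}"
    by auto
  have "(q a (w j) v, \<pi> b) \<in> S ^^ 3"
    by (rule crossing_to_projection(1)[OF v far _ s _ b, of "T a (w j)"]) (auto simp: w_def)
  \<comment> \<open>The same crossing at the start of the line: \<open>a\<close> is the end of its
    own ray, at time \<open>T m a\<close>.\<close>
  moreover have "(\<pi> a, q a (w j) v) \<in> S ^^ 3"
    by (rule crossing_to_projection(2)[OF v far _ _ _ a, of 0 "T m a"]) auto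
  ultimately have "(\<pi> a, \<pi> b) \<in> S ^^ (3 + 3)"
    unfolding relpow_add by blast
  then show ?thesis
    by simp
qed

text \<open>The combing line between the ends stays within \<open>c \<le> R / 4\<close> of the
  piece, hence outside the ball of radius \<open>R / 2\<close>.\<close>

lemma far_path_projection:
  assumes p: "p \<in> combing_path_system q T" and far: "\<And>z. z \<in> path_image p \<Longrightarrow> R \<le> dist m z"
  shows "(\<pi> (pathstart p), \<pi> (pathfinish p)) \<in> S ^^ 6"
proof (rule far_line_projection)
  show "R / 2 < dist m (q (pathstart p) (pathfinish p) t)" for t
  proof -
    obtain z where z: "z \<in> path_image p" "dist (q (pathstart p) (pathfinish p) t) z \<le> c"
      using q_near_combing_path[OF p] .
    then show ?thesis
      using far[OF z(1)] R_ge_c R_ge_1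
        dist_triangle[of m z "q (pathstart p) (pathfinish p) t"] by linarith
  qed
qed (use far in auto)

lemma path_list_projection:
  assumes "ps \<noteq> []" "successively (\<lambda>p p'. pathfinish p = pathstart p') ps"
    and "set ps \<subseteq> combing_path_system q T" "\<And>p z. p \<in> set ps \<Longrightarrow> z \<in> path_image p \<Longrightarrow> R \<le> dist m z"
  shows "(\<pi> (pathstart (hd ps)), \<pi> (pathfinish (last ps))) \<in> S ^^ (6 * length ps)"
  using assms
proof (induction ps rule: join_path_list.induct)
  case (2 p)
  then have "(\<pi> (pathstart p), \<pi> (pathfinish p)) \<in> S ^^ 6"
    by (intro far_path_projection) auto
  then show ?case
    by simp
next
  case (3 p p' ps)
  have "(\<pi> (pathstart p), \<pi> (pathfinish p)) \<in> S ^^ 6"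
    using 3(4,5) by (intro far_path_projection) auto
  moreover have "(\<pi> (pathstart p'), \<pi> (pathfinish (last (p' # ps)))) \<in> S ^^ (6 * length (p' # ps))"
    using "3.IH" "3.prems"(2,3) "3.prems"(4)[OF list.set_intros(2)] by auto
  ultimately have "(\<pi> (pathstart p), \<pi> (pathfinish (last (p' # ps)))) \<in> S ^^ (6 + 6 * length (p' # ps))"
    unfolding relpow_add using 3(3) by auto
  then show ?case
    by simp
qed auto

text \<open>Serves the two ends of the polygonal line, which lie within \<open>2 * R\<close> of
  \<open>m\<close>. Intermediate vertices may be arbitrarily far away and enter only through their
  projections.\<close>

lemma S_projection:
  assumes "R \<le> dist m x" "dist m x \<le> 2 * R"
  shows "(x, \<pi> x) \<in> S"
proof -
  have "2 * R \<le> M * R"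
    using M_ge R_ge_1 by (intro mult_right_mono) auto
  then have "dist m x \<le> M * R"
    using assms(2) by linarith
  then show ?thesis
    using S_ray[OF assms(1), of "T m x"] assms R_ge_1 by auto
qed

lemma polygonal_line_detour:
  assumes "polygonal_line n (combing_path_system q T) \<alpha>" "R \<le> infdist m (path_image \<alpha>)"
    and "dist (pathstart \<alpha>) m \<le> 2 * R" "dist (pathfinish \<alpha>) m \<le> 2 * R"
  shows "\<exists>p. polygonal_line (8 * n) (combing_path_system q T) p \<and>
    pathstart p = pathstart \<alpha> \<and> pathfinish p = pathfinish \<alpha> \<and>
    curve_length 0 1 p \<le> ereal (real (8 * n) * ((2 * k1 * M + k2) * R)) \<and>
    path_image p \<inter> cball m \<rho> = {}"
proof -
  obtain ps where ps: "ps \<noteq> []" "length ps \<le> n" "set ps \<subseteq> combing_path_system q T"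
    "successively (\<lambda>p p'. pathfinish p = pathstart p') ps" "\<alpha> = join_path_list ps"
    using assms(1) by (auto simp: polygonal_line_def)
  have far: "R \<le> dist m z" if "z \<in> path_image \<alpha>" for z
    using infdist_le[OF that, of m] assms(2) by linarith
  have "(\<pi> (pathstart (hd ps)), \<pi> (pathfinish (last ps))) \<in> S ^^ (6 * length ps)"
    using ps far by (intro path_list_projection) (auto simp: path_image_join_path_list)
  then have "(\<pi> (pathstart \<alpha>), \<pi> (pathfinish \<alpha>)) \<in> S ^^ (6 * length ps)"
    using ps by (simp add: path_ends_join_path_list)
  moreover have "(pathstart \<alpha>, \<pi> (pathstart \<alpha>)) \<in> S" "(\<pi> (pathfinish \<alpha>), pathfinish \<alpha>) \<in> S"
    using assms(3,4) by (auto intro!: S_projection symD[OF sym_S, of "pathfinish \<alpha>"] far simp: dist_commute)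
  ultimately have "(pathstart \<alpha>, pathfinish \<alpha>) \<in> S ^^ (1 + 6 * length ps + 1)"
    unfolding relpow_add by auto
  \<comment> \<open>Six steps per piece and one at each end; there is at least one piece, so eight
    per piece suffice.\<close>
  moreover have "1 + 6 * length ps + 1 \<le> 8 * n"
    using ps(1,2) by (cases ps) auto
  moreover have "0 \<le> (2 * k1 * M + k2) * R"
    using k1_nonneg k2_nonneg M_ge R_ge_1 by simp
  ultimately show ?thesis
    unfolding S_def by (intro relpow_step_relation_imp_polygonal_line) auto
qed

end

section \<open>Choice of the navigability constants\<close>

theorem proposition1p14:
  fixes q :: "'a::metric_space \<Rightarrow> 'a \<Rightarrow> real \<Rightarrow> 'a"
    and T :: "'a \<Rightarrow> 'a \<Rightarrow> real"
    and l0 k0 :: real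
  assumes "geodesic_space TYPE('a)"
    and "l0 \<ge> 1" and "k0 \<ge> 0"
    and "quasi_geodesic_bicombing l0 k0 q T"
    and "bounded_bicombing k0 q"
    and "quasi_consistent k0 q T"
  shows "navigable (combing_path_system q T)"
proof -
  interpret quasi_consistent_bicombing q T l0 k0
    using assms by unfold_locales
  \<comment> \<open>The length constant \<open>2 * k1 * M + k2\<close> of a step with
    \<open>M\<close> and \<open>K\<close> expanded, since it must be fixed before \<open>m\<close>
    and \<open>R\<close>.\<close>
  define L where "L = 2 * k1 * (l0 * l0 * (l0 * l0 * (k0 + 1) + k0 + 4) + k0 + 4) + k2"
  \<comment> \<open>A sum of nonnegative terms dominates each requirement: the lower bounds on
    \<open>R\<close>, the factor in \<rho>, and the total length of eight steps per piece.\<close>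
  define C where "C = 1 + 4 * c + 8 * (k0 * (l0 + k0) + k0) + 16 * (l0 * l0) * k0
    + 32 * (l0 * l0) + 8 * L"
  have "0 \<le> L" "0 \<le> c" "0 \<le> k0 * (l0 + k0)" "0 \<le> l0 * l0" "0 \<le> (l0 * l0) * k0" "1 \<le> l0 * l0"
    using k1_nonneg k2_nonneg assms(2,3) mult_mono[of 1 l0 1 l0] by (auto simp: L_def c_def)
  then have C: "1 \<le> C" "4 * c \<le> C" "8 * (k0 * (l0 + k0) + k0) \<le> C" "16 * (l0 * l0) * k0 \<le> C"
    "32 * (l0 * l0) \<le> C" "8 * L \<le> C"
    using assms(2,3) by (auto simp: C_def)
  show ?thesis
    unfolding navigable_def
  proof (rule exI[of _ C], rule exI[of _ 8], intro conjI allI impI)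
    fix R m n \<alpha>
    assume *: "C \<le> R \<and> polygonal_line n (combing_path_system q T) \<alpha> \<and>
      R \<le> infdist m (path_image \<alpha>) \<and> dist (pathstart \<alpha>) m \<le> 2 * R \<and> dist (pathfinish \<alpha>) m \<le> 2 * R"
    interpret bicombing_at_scale q T l0 k0 m R
      using * C by unfold_locales auto
    have L: "2 * k1 * M + k2 = L"
      by (simp add: L_def M_def K_def)
    obtain p where p: "polygonal_line (8 * n) (combing_path_system q T) p"
      "pathstart p = pathstart \<alpha>" "pathfinish p = pathfinish \<alpha>"
      "curve_length 0 1 p \<le> ereal (real (8 * n) * (L * R))" "path_image p \<inter> cball m \<rho> = {}"
      using polygonal_line_detour[of n \<alpha>] * unfolding L by blast
    have "real (8 * n) * (L * R) = (8 * L) * (real n * R)"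
      by simp
    also have "\<dots> \<le> C * (real n * R)"
      using C(6) R_ge_1 by (intro mult_right_mono) auto
    finally have "ereal (real (8 * n) * (L * R)) \<le> ereal (C * real n * R)"
      by (simp add: mult.assoc)
    moreover have "R / C \<le> \<rho>"
      unfolding \<rho>_def using C(1,5) R_ge_1 l_sq_ge_1 by (intro divide_left_mono) auto
    then have "cball m (R / C) \<subseteq> cball m \<rho>"
      by auto
    ultimately show "\<exists>p. polygonal_line (8 * n) (combing_path_system q T) p \<and>
        pathstart p = pathstart \<alpha> \<and> pathfinish p = pathfinish \<alpha> \<and>
        curve_length 0 1 p \<le> ereal (C * real n * R) \<and> path_image p \<inter> cball m (R / C) = {}"
      using p by (intro exI[of _ p]) (auto intro: order_trans)
  qed (use C in auto)
qed

end
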